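(* Define $g(a,b)=\max\{a,\,b,\,1/a,\,1/b\}$ for $a>0$, $b>0$. Then $g$ attains its minimum over $(0,\infty)^2$ at $(a,b)$ if and only if $a=b=1$. *)

theory Defs
  imports Complex_Main
begin

(* Only meaningful on positive arguments; elsewhere the value is an artefact of totality. *)
definition g :: "real \<times> real \<Rightarrow> real" where
  "g = (\<lambda>(a, b). Max {a, b, 1 / a, 1 / b})"

end

theory Submission
  imports Defs
begin

text \<open>
  For positive \<open>x\<close>, one of \<open>x\<close> and \<open>1 / x\<close> is at least \<open>1\<close>, and both are at most \<open>1\<close> only when
  \<open>x = 1\<close>. Hence \<open>1\<close> is a lower bound of \<open>g\<close> on the positive quadrant, and \<open>(1, 1)\<close> is the only
  point at which it is attained.
\<close>

lemma g_ge_1: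
  assumes "a > 0"
  shows "1 \<le> g (a, b)"
proof -
  have "1 \<le> a \<or> 1 \<le> 1 / a"
    using assms by (auto simp: le_divide_eq)
  then show ?thesis
    by (auto simp: g_def le_max_iff_disj)
qed

lemma g_le_1_iff:
  assumes "a > 0" "b > 0"
  shows "g (a, b) \<le> 1 \<longleftrightarrow> a = 1 \<and> b = 1"
  using assms by (auto simp: g_def divide_le_eq)

theorem proposition3p1:
  fixes a b :: real
  shows "is_arg_min g (\<lambda>p. p \<in> {0<..} \<times> {0<..}) (a, b) \<longleftrightarrow> a = 1 \<and> b = 1"
proof
  assume min: "is_arg_min g (\<lambda>p. p \<in> {0<..} \<times> {0<..}) (a, b)"
  then have pos: "a > 0" "b > 0"
    by (auto simp: is_arg_min_def)
  have "g (a, b) \<le> g (1, 1)"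
    using min by (force simp: is_arg_min_def not_less)
  also have "g (1, 1) \<le> 1"
    by (simp add: g_le_1_iff)
  finally show "a = 1 \<and> b = 1"
    using pos by (simp add: g_le_1_iff)
next
  assume "a = 1 \<and> b = 1"
  then have "g (a, b) \<le> 1"
    by (simp add: g_le_1_iff)
  then have "g (a, b) \<le> g (x, y)" if "x > 0" for x y
    using g_ge_1[OF that, of y] by linarith
  then show "is_arg_min g (\<lambda>p. p \<in> {0<..} \<times> {0<..}) (a, b)"
    using \<open>a = 1 \<and> b = 1\<close> by (auto simp: is_arg_min_def not_less)
qed

end
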